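(* Let $\mathbb{Q}$ (with expectation $\mathbb{E}$) be the law of a translation-invariant, finite-range self-interacting random walk on $\mathbb{Z}^d$ started at the origin, with expansion coefficients $\{\pi_m\}_{m\ge2}$ as defined in the context, and let $a_m^{[i]}=\sum_y y^{[i]}\pi_m(y)$. Suppose that for all $i,j\in\{1,\dots,d\}$, $$\lim_{n\to\infty}\frac{\mathbb{E}[\omega_n^{[i]}\omega_n^{[j]}]-\mathbb{E}[\omega_n^{[i]}]\,\mathbb{E}[\omega_n^{[j]}]}{n}=\Sigma_{ij}$$ exists, that the series $\sum_{m=2}^\infty\sum_y y^{[i]}y^{[j]}\pi_m(y)$ converges, and that either (i) $\mathbb{E}[\omega_n]=0$ for each $n$ (in which case put $\theta=0$), or (ii) $n^{-1}\omega_n\to\theta$ in probability under $\mathbb{Q}$ for some $\theta\in\mathbb{R}^d$, and $\sum_{m=2}^\infty(m-1)|a_m^{[i]}|<\infty$ for each $i$. Then for all $i,j$, $$\Sigma_{ij}=(\Sigma_{\varnothing})_{ij}-\theta^{[i]}\theta^{[j]}-\sum_{m=2}^\infty\Big[\theta^{[i]}(m-1)a_m^{[j]}+\theta^{[j]}(m-1)a_m^{[i]}-\sum_y y^{[i]}y^{[j]}\pi_m(y)\Big],$$ where $(\Sigma_{\varnothing})_{ij}=\sum_x x^{[i]}x^{[j]}D(x)$ and $D(x)=\mathbb{Q}(\omega_1=x)$.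
   Context: $v^{[i]}$ denotes the $i$-th coordinate of a vector $v$. Self-interacting random walk. A finite path is $\vec{x}_i=(x_0,\dots,x_i)$ with $x_j\in\mathbb{Z}^d$. For every finite path $\vec{x}_i$ a probability mass function $y\mapsto p^{\vec{x}_i}(x_i,y)$ on $\mathbb{Z}^d$ is given (the conditional probability of stepping from $x_i$ to $y$ given the history $\vec{x}_i$). It is translation invariant, i.e. unchanged when the whole path and $y$ are shifted by the same vector, and has finite range $L<\infty$, i.e. $p^{\vec{x}_i}(x_i,y)=0$ if $|y-x_i|>L$. The walk $\vec\omega=(\omega_0,\omega_1,\dots)$ started at the origin $o$ has law $\mathbb{Q}$ given by $\mathbb{Q}(\vec\omega_n=(x_0,\dots,x_n))=\prod_{i=0}^{n-1}p^{\vec{x}_i}(x_i,x_{i+1})$ for $x_0=o$, where $\vec\omega_n=(\omega_0,\dots,\omega_n)$. Thus $D(x)=p^{o}(o,x)$. Concatenation. If $\vec\eta_j=(\eta_0,\dots,\eta_j)$ and $\vec{x}_m=(x_0,\dots,x_m)$ with $\eta_j=x_0$, then $\vec\eta_j\circ\vec{x}_m=(\eta_0,\dots,\eta_j,x_1,\dots,x_m)$. Expansion coefficients. For $N\ge1$ and $m\ge 2$ let $\mathcal{A}_{m,N}=\{(j_1,\dots,j_N)\in\mathbb{Z}_{\ge0}^N: j_1+\dots+j_N=m-N-1\}$ and set $j_0=0$. For $\vec{j}\in\mathcal{A}_{m,N}$ consider paths $\vec\omega^{(0)}_1=(o,\omega^{(0)}_1)$ and, for $n=1,\dots,N$, $\vec\omega^{(n)}_{j_n+1}=(\omega^{(n)}_0,\dots,\omega^{(n)}_{j_n+1})$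 with $\omega^{(n)}_0=\omega^{(n-1)}_{j_{n-1}+1}$; $\vec\omega^{(n)}_i$ denotes the first $i$ steps of $\vec\omega^{(n)}_{j_n+1}$. Put $$\Delta^{(n)}_{j_n+1}=\Big(p^{\vec\omega^{(n-1)}_{j_{n-1}+1}\circ\vec\omega^{(n)}_{j_n}}-p^{\vec\omega^{(n)}_{j_n}}\Big)\big(\omega^{(n)}_{j_n},\omega^{(n)}_{j_n+1}\big),$$ $$\pi_m^{(N)}(y)=\sum_{\vec{j}\in\mathcal{A}_{m,N}}\ \sum_{\vec\omega^{(0)}_1}\sum_{\vec\omega^{(1)}_{j_1+1}}\cdots\sum_{\vec\omega^{(N)}_{j_N+1}} I_{\{\omega^{(N)}_{j_N+1}=y\}}\,D(\omega^{(0)}_1)\prod_{n=1}^N\Delta^{(n)}_{j_n+1}\prod_{i=0}^{j_n-1}p^{\vec\omega^{(n-1)}_{j_{n-1}+1}\circ\vec\omega^{(n)}_{i}}\big(\omega^{(n)}_i,\omega^{(n)}_{i+1}\big),$$ the sums being over all such paths and empty products being $1$. Finally $\pi_m(y)=\sum_{N=1}^\infty\pi_m^{(N)}(y)$ (the terms with $N+1>m$ vanish). *)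

theory Defs
  imports "HOL-Probability.Probability"
begin

type_synonym 'd point = "int ^ 'd"

text \<open>A finite path \<open>(x\<^sub>0, \<dots>, x\<^sub>i)\<close> is the nonempty list of its \<open>i + 1\<close> vertices, so its number of
  steps is its length minus one.\<close>

type_synonym 'd path = "'d point list"

text \<open>\<open>pmf (p xs) y\<close> is the probability of stepping from \<open>last xs\<close> to \<open>y\<close> given the history \<open>xs\<close>.
  The value of a kernel at the empty list plays no role.\<close>

type_synonym 'd kernel = "'d path \<Rightarrow> 'd point pmf"

definition rvec :: "'d::finite point \<Rightarrow> real ^ 'd" where
  "rvec x = (\<chi> i. real_of_int (x $ i))"

definition translation_invariant :: "'d::finite kernel \<Rightarrow> bool" where
  "translation_invariant p \<longleftrightarrow>
     (\<forall>xs y v. xs \<noteq> [] \<longrightarrow> pmf (p (map (\<lambda>x. x + v) xs)) (y + v) = pmf (p xs) y)"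

definition finite_range :: "'d::finite kernel \<Rightarrow> real \<Rightarrow> bool" where
  "finite_range p L \<longleftrightarrow>
     (\<forall>xs y. xs \<noteq> [] \<longrightarrow> norm (rvec (y - last xs)) > L \<longrightarrow> pmf (p xs) y = 0)"

text \<open>The law on trajectories of the walk started at the origin. The coordinate \<open>\<omega>\<^sub>n\<close> is
  \<open>\<lambda>w. w n\<close>. For \<open>n = 0\<close> the last condition says that \<open>\<omega>\<^sub>0 = 0\<close> almost surely; the finite-dimensional
  distributions determine the measure on the product sigma-algebra.\<close>

definition walk_law :: "'d::finite kernel \<Rightarrow> (nat \<Rightarrow> 'd point) measure \<Rightarrow> bool" where
  "walk_law p Q \<longleftrightarrow>
     prob_space Q \<and>
     sets Q = sets (Pi\<^sub>M UNIV (\<lambda>_. count_space UNIV)) \<and>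
     (\<forall>n xs. length xs = Suc n \<longrightarrow> xs ! 0 = 0 \<longrightarrow>
        measure Q {w \<in> space Q. map w [0..<Suc n] = xs} =
          (\<Prod>i<n. pmf (p (take (Suc i) xs)) (xs ! Suc i)))"

definition D :: "'d::finite kernel \<Rightarrow> 'd point \<Rightarrow> real" where
  "D p x = pmf (p [0]) x"

definition converges_in_prob ::
    "'a measure \<Rightarrow> (nat \<Rightarrow> 'a \<Rightarrow> 'b::metric_space) \<Rightarrow> 'b \<Rightarrow> bool" where
  "converges_in_prob M X c \<longleftrightarrow>
     (\<forall>\<epsilon>>0. (\<lambda>n. measure M {w \<in> space M. dist (X n w) c > \<epsilon>}) \<longlonglongrightarrow> 0)"

text \<open>Concatenation of paths, meant for \<open>last \<eta> = hd x\<close>.\<close>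

definition concat_path :: "'d path \<Rightarrow> 'd path \<Rightarrow> 'd path" (infixl "\<odot>" 65) where
  "\<eta> \<odot> x = \<eta> @ tl x"

text \<open>The index set \<open>\<A>\<^bsub>m,N\<^esub>\<close>; the equation \<open>j\<^sub>1 + \<dots> + j\<^sub>N = m - N - 1\<close> is written without truncated
  subtraction, so that the set is empty for \<open>m < N + 1\<close>.\<close>

definition index_set :: "nat \<Rightarrow> nat \<Rightarrow> nat list set" where
  "index_set m N = {js. length js = N \<and> sum_list js + N + 1 = m}"

text \<open>The list \<open>js\<close> contains \<open>j\<^sub>1, \<dots>, j\<^sub>N\<close>, and \<open>j\<^sub>0 = 0\<close>.\<close>

definition idx :: "nat list \<Rightarrow> nat \<Rightarrow> nat" where
  "idx js n = (0 # js) ! n"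

text \<open>The tuples \<open>(\<omega>\<^sup>(\<^sup>0\<^sup>), \<dots>, \<omega>\<^sup>(\<^sup>N\<^sup>))\<close> of paths over which one sums, where \<open>ws ! n\<close> is \<open>\<omega>\<^sup>(\<^sup>n\<^sup>)\<close> and has
  \<open>j\<^sub>n + 1\<close> steps.\<close>

definition path_tuples :: "nat list \<Rightarrow> 'd::finite path list set" where
  "path_tuples js = {ws. length ws = Suc (length js) \<and>
     (\<forall>n \<le> length js. length (ws ! n) = idx js n + 2) \<and>
     hd (ws ! 0) = 0 \<and>
     (\<forall>n \<in> {1..length js}. hd (ws ! n) = last (ws ! (n - 1)))}"

text \<open>The initial piece \<open>\<omega>\<^sup>(\<^sup>n\<^sup>)\<^sub>i\<close> of \<open>i\<close> steps is \<open>take (Suc i) (ws ! n)\<close>.\<close>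

definition \<Delta> :: "'d::finite kernel \<Rightarrow> nat list \<Rightarrow> 'd path list \<Rightarrow> nat \<Rightarrow> real" where
  "\<Delta> p js ws n =
     (let j = idx js n; \<omega> = ws ! n; \<omega>' = take (Suc j) \<omega> in
        pmf (p (ws ! (n - 1) \<odot> \<omega>')) (\<omega> ! Suc j) - pmf (p \<omega>') (\<omega> ! Suc j))"

text \<open>The infinite sums below have only finitely many nonzero terms for a kernel of finite range.\<close>

definition \<pi>N :: "'d::finite kernel \<Rightarrow> nat \<Rightarrow> nat \<Rightarrow> 'd point \<Rightarrow> real" where
  "\<pi>N p N m y =
     (\<Sum>js \<in> index_set m N. \<Sum>\<^sub>\<infinity>ws \<in> path_tuples js.
        of_bool (ws ! N ! Suc (idx js N) = y) * D p (ws ! 0 ! 1) *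
        (\<Prod>n=1..N. \<Delta> p js ws n *
           (\<Prod>i<idx js n. pmf (p (ws ! (n - 1) \<odot> take (Suc i) (ws ! n))) (ws ! n ! Suc i))))"

definition \<pi> :: "'d::finite kernel \<Rightarrow> nat \<Rightarrow> 'd point \<Rightarrow> real" where
  "\<pi> p m y = (\<Sum>\<^sub>\<infinity>N \<in> {1..}. \<pi>N p N m y)"

text \<open>The first moments \<open>first_moment p m i\<close> are the numbers \<open>a\<^sub>m\<^bsup>[i]\<^esup>\<close>.\<close>

definition first_moment :: "'d::finite kernel \<Rightarrow> nat \<Rightarrow> 'd \<Rightarrow> real" where
  "first_moment p m i = (\<Sum>\<^sub>\<infinity>y. real_of_int (y $ i) * \<pi> p m y)"

definition second_moment :: "'d::finite kernel \<Rightarrow> nat \<Rightarrow> 'd \<Rightarrow> 'd \<Rightarrow> real" where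
  "second_moment p m i j = (\<Sum>\<^sub>\<infinity>y. real_of_int (y $ i) * real_of_int (y $ j) * \<pi> p m y)"

definition Sigma_empty :: "'d::finite kernel \<Rightarrow> 'd \<Rightarrow> 'd \<Rightarrow> real" where
  "Sigma_empty p i j = (\<Sum>\<^sub>\<infinity>x. real_of_int (x $ i) * real_of_int (x $ j) * D p x)"

end

theory Submission
  imports Defs
begin

text \<open>
  Conditioning on the first step, the rest of the walk from \<open>x = \<omega>\<^sub>1\<close> is governed by kernels that
  remember the path \<open>(0, x)\<close>. A telescoping sum exchanges these kernels for those of a walk newly
  started at \<open>x\<close>. The \<open>j\<close>-th error term has one factor that is a difference of the two kernels;
  after it, the walk remembers only the piece \<open>\<omega>'\<close> of \<open>j + 1\<close> steps that has just been traversed,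
  so the same exchange applies to the remaining walk with \<open>\<omega>'\<close> as its history
  (\<open>forget_history\<close>). Iterating until no history is left produces all the sums over chained tuples of
  paths that define \<open>\<pi>\<^sub>m\<close> (\<open>iterated_expansion\<close>, \<open>has_sum_\<pi>\<close>). With translation invariance this says
  \<open>E f(\<omega>\<^bsub>n+1\<^esub>) = \<Sum>\<^sub>x D(x) E f(x + \<omega>\<^sub>n) + \<Sum>\<^bsub>2\<le>m\<le>n+1\<^esub> \<Sum>\<^sub>y \<pi>\<^sub>m(y) E f(y + \<omega>\<^bsub>n+1-m\<^esub>)\<close>.

  The last factor of every term of \<open>\<pi>\<^sub>m\<close> is a difference of two probability mass functions in the
  last vertex, so \<open>\<Sum>\<^sub>y \<pi>\<^sub>m(y) = 0\<close>. Therefore, for coordinates and for products of two coordinates,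
  only first and second moments of \<open>\<pi>\<^sub>m\<close> survive. Write \<open>e\<^sub>n\<close>, \<open>e'\<^sub>n\<close> for the expectations of the
  two coordinates, \<open>a\<^sub>m\<close>, \<open>a'\<^sub>m\<close> for the first moments and \<open>s\<^sub>m\<close> for the second moment of \<open>\<pi>\<^sub>m\<close>,
  and \<open>\<delta>\<^sub>n = e\<^bsub>n+1\<^esub> - e\<^sub>n = E \<omega>\<^sub>1 + a\<^sub>2 + \<dots> + a\<^bsub>n+1\<^esub>\<close>. The increment of the covariance
  from \<open>n\<close> to \<open>n + 1\<close> is
  \<open>\<Sigma>\<^sub>\<emptyset> - \<delta>\<^sub>n \<delta>'\<^sub>n + \<Sum>\<^sub>m (s\<^sub>m - a\<^sub>m (e'\<^sub>n - e'\<^bsub>n+1-m\<^esub>) - a'\<^sub>m (e\<^sub>n - e\<^bsub>n+1-m\<^esub>))\<close>,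
  the sum being over \<open>2 \<le> m \<le> n + 1\<close>. The increments \<open>\<delta>\<^sub>n\<close> converge, and the limit must be the
  coordinate of \<open>\<theta>\<close>, written \<open>\<theta>\<close> again, because \<open>\<omega>\<^sub>n / n\<close> is bounded and tends to \<open>\<theta>\<close> in probability,
  so that \<open>e\<^sub>n / n\<close> tends to \<open>\<theta>\<close>. Each difference \<open>e\<^sub>n - e\<^bsub>n+1-m\<^esub>\<close> consists of \<open>m - 1\<close> bounded
  increments and tends to \<open>(m - 1) \<theta>\<close>, so summability of \<open>(m - 1) |a\<^sub>m|\<close> lets the limit pass inside
  the sum. This gives the claimed value as the limit of the covariance increments, hence
  (\<open>stolz_cesaro\<close>) of the covariance divided by \<open>n\<close> (\<open>variance_limit\<close>).

  A centred walk is the special case in which all \<open>a\<^sub>m\<close> vanish: then \<open>E \<omega>\<^sub>1 + a\<^sub>2 + \<dots> + a\<^bsub>n+1\<^esub> = 0\<close>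
  for every \<open>n\<close>.
\<close>

section \<open>Sums over paths with steps in a finite set\<close>

text \<open>All steps of positive probability lie in the finite set \<open>R\<close>, which turns every sum over paths into
  a finite one.\<close>

locale short_range_kernel =
  fixes p :: "'d::finite kernel" and R :: "'d point set"
  assumes finite_R: "finite R"
    and step_in_R: "xs \<noteq> [] \<Longrightarrow> pmf (p xs) y \<noteq> 0 \<Longrightarrow> y - last xs \<in> R"
begin

lemma sum_step_probabilities:
  assumes "xs \<noteq> []"
  shows "(\<Sum>z\<in>R. pmf (p xs) (last xs + z)) = 1"
proof -
  have "(\<Sum>z\<in>R. pmf (p xs) (last xs + z)) = (\<Sum>y\<in>(+) (last xs) ` R. pmf (p xs) y)"
    by (subst sum.reindex) auto
  also have "\<dots> = 1"
  proof (rule sum_pmf_eq_1)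
    show "set_pmf (p xs) \<subseteq> (+) (last xs) ` R"
    proof
      fix y assume "y \<in> set_pmf (p xs)"
      then have "y - last xs \<in> R" using assms by (intro step_in_R) (auto simp: set_pmf_iff)
      then show "y \<in> (+) (last xs) ` R" by (intro image_eqI[where x="y - last xs"]) auto
    qed
  qed (use finite_R in auto)
  finally show ?thesis .
qed

text \<open>Paths grow at their end, since the weight of a step depends on the initial piece before it.\<close>

primrec paths :: "'d point \<Rightarrow> nat \<Rightarrow> 'd path set" where
  "paths x 0 = {[x]}"
| "paths x (Suc n) = (\<lambda>(\<omega>, z). \<omega> @ [last \<omega> + z]) ` (paths x n \<times> R)"

lemma finite_paths: "finite (paths x n)"
  by (induction n) (auto simp: finite_R)

lemma paths_length: "\<omega> \<in> paths x n \<Longrightarrow> length \<omega> = Suc n"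
  by (induction n arbitrary: \<omega>) auto

lemma paths_nonempty: "\<omega> \<in> paths x n \<Longrightarrow> \<omega> \<noteq> []"
  using paths_length by fastforce

lemma paths_hd: "\<omega> \<in> paths x n \<Longrightarrow> hd \<omega> = x"
  by (induction n arbitrary: \<omega>) (auto simp: paths_nonempty)

lemma sum_paths_Suc:
  "(\<Sum>\<omega>\<in>paths x (Suc n). G \<omega>) = (\<Sum>\<omega>\<in>paths x n. \<Sum>z\<in>R. G (\<omega> @ [last \<omega> + z]))"
  unfolding paths.simps sum.cartesian_product
  by (subst sum.reindex) (auto simp: inj_on_def case_prod_unfold)

lemma in_paths_iff:
  "\<omega> \<in> paths x n \<longleftrightarrow> length \<omega> = Suc n \<and> hd \<omega> = x \<and> (\<forall>i<n. \<omega> ! Suc i - \<omega> ! i \<in> R)"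
proof (induction n arbitrary: \<omega>)
  case 0
  then show ?case by (cases \<omega>) auto
next
  case (Suc n)
  show ?case
  proof (cases \<omega> rule: rev_cases)
    case Nil
    then show ?thesis by auto
  next
    case (snoc \<eta> y)
    have last_nth: "length \<eta> = Suc n \<Longrightarrow> last \<eta> = \<eta> ! n"
      by (subst last_conv_nth) auto
    have "\<omega> \<in> paths x (Suc n) \<longleftrightarrow> \<eta> \<in> paths x n \<and> y - last \<eta> \<in> R"
      unfolding snoc paths.simps
      by (auto simp: image_iff intro!: bexI[where x="(\<eta>, y - last \<eta>)"] bexI[where x="y - last \<eta>"])
    also have "\<dots> \<longleftrightarrow> length \<eta> = Suc n \<and> hd \<eta> = x \<and> (\<forall>i<n. \<eta> ! Suc i - \<eta> ! i \<in> R) \<and> y - \<eta> ! n \<in> R"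
      unfolding Suc.IH by (auto simp: last_nth)
    also have "\<dots> \<longleftrightarrow> length \<omega> = Suc (Suc n) \<and> hd \<omega> = x \<and> (\<forall>i<Suc n. \<omega> ! Suc i - \<omega> ! i \<in> R)"
      unfolding snoc All_less_Suc by (cases "\<eta> = []") (auto simp: nth_append)
    finally show ?thesis .
  qed
qed

text \<open>The weight of \<open>\<omega>\<close> as a continuation of the history \<open>\<eta>\<close>, which ends where \<open>\<omega>\<close> starts. For the
  one-vertex history \<open>\<eta> = [hd \<omega>]\<close> it is the weight of a walk without a past.\<close>

definition path_weight :: "'d path \<Rightarrow> nat \<Rightarrow> 'd path \<Rightarrow> real" where
  "path_weight \<eta> n \<omega> = (\<Prod>i<n. pmf (p (\<eta> \<odot> take (Suc i) \<omega>)) (\<omega> ! Suc i))"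

text \<open>The difference \<open>\<Delta>\<close> of the expansion, for the last step of a path \<open>\<omega>\<close> of \<open>j + 1\<close> steps that follows
  the history \<open>\<eta>\<close>.\<close>

definition memory_gap :: "'d path \<Rightarrow> nat \<Rightarrow> 'd path \<Rightarrow> real" where
  "memory_gap \<eta> j \<omega> =
     pmf (p (\<eta> \<odot> take (Suc j) \<omega>)) (\<omega> ! Suc j) - pmf (p (take (Suc j) \<omega>)) (\<omega> ! Suc j)"

lemma path_weight_0 [simp]: "path_weight \<eta> 0 \<omega> = 1"
  by (simp add: path_weight_def)

lemma path_weight_snoc:
  assumes "length \<omega> = Suc n"
  shows "path_weight \<eta> n (\<omega> @ [y]) = path_weight \<eta> n \<omega>"
    and "path_weight \<eta> (Suc n) (\<omega> @ [y]) = path_weight \<eta> n \<omega> * pmf (p (\<eta> \<odot> \<omega>)) y"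
proof -
  show *: "path_weight \<eta> n (\<omega> @ [y]) = path_weight \<eta> n \<omega>"
    unfolding path_weight_def using assms by (intro prod.cong) (auto simp: nth_append)
  have "path_weight \<eta> (Suc n) (\<omega> @ [y]) = path_weight \<eta> n (\<omega> @ [y]) * pmf (p (\<eta> \<odot> \<omega>)) y"
    using assms by (simp add: path_weight_def nth_append)
  then show "path_weight \<eta> (Suc n) (\<omega> @ [y]) = path_weight \<eta> n \<omega> * pmf (p (\<eta> \<odot> \<omega>)) y"
    using * by simp
qed

lemma sum_memory_gap:
  "(\<Sum>\<omega>\<in>paths x (Suc j). memory_gap \<eta> j \<omega> * path_weight \<eta> j \<omega> * G \<omega>) =
   (\<Sum>\<omega>\<in>paths x j. path_weight \<eta> j \<omega> *
      (\<Sum>z\<in>R. (pmf (p (\<eta> \<odot> \<omega>)) (last \<omega> + z) - pmf (p \<omega>) (last \<omega> + z)) *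
             G (\<omega> @ [last \<omega> + z])))"
  unfolding sum_paths_Suc sum_distrib_left
  by (intro sum.cong refl)
    (auto simp: path_weight_snoc paths_length memory_gap_def nth_append)

section \<open>Forgetting the history\<close>

text \<open>The conditional expectation of \<open>f\<close> at the endpoint of \<open>n\<close> further steps, given the history \<open>\<eta>\<close>.\<close>

primrec walk_expectation :: "nat \<Rightarrow> 'd path \<Rightarrow> ('d point \<Rightarrow> real) \<Rightarrow> real" where
  "walk_expectation 0 \<eta> f = f (last \<eta>)"
| "walk_expectation (Suc n) \<eta> f =
     (\<Sum>z\<in>R. pmf (p \<eta>) (last \<eta> + z) * walk_expectation n (\<eta> @ [last \<eta> + z]) f)"

lemma concat_path_snoc: "\<omega> \<noteq> [] \<Longrightarrow> (\<eta> \<odot> \<omega>) @ [y] = \<eta> \<odot> (\<omega> @ [y])"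
  by (simp add: concat_path_def)

lemma last_concat_path: "\<omega> \<noteq> [] \<Longrightarrow> \<eta> \<noteq> [] \<Longrightarrow> last \<eta> = hd \<omega> \<Longrightarrow> last (\<eta> \<odot> \<omega>) = last \<omega>"
  by (cases \<omega>) (auto simp: concat_path_def last_append)

lemma concat_path_nonempty: "\<eta> \<noteq> [] \<Longrightarrow> \<eta> \<odot> \<omega> \<noteq> []"
  by (simp add: concat_path_def)

lemma walk_expectation_add:
  "walk_expectation n \<eta> (\<lambda>x. f x + g x) = walk_expectation n \<eta> f + walk_expectation n \<eta> g"
  by (induction n arbitrary: \<eta>) (auto simp: algebra_simps sum.distrib)

lemma walk_expectation_cmult:
  "walk_expectation n \<eta> (\<lambda>x. c * f x) = c * walk_expectation n \<eta> f"
  by (induction n arbitrary: \<eta>) (auto simp: algebra_simps sum_distrib_left)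

lemma walk_expectation_const:
  "\<eta> \<noteq> [] \<Longrightarrow> walk_expectation n \<eta> (\<lambda>x. c) = c"
  by (induction n arbitrary: \<eta>) (auto simp: sum_step_probabilities simp flip: sum_distrib_right)

text \<open>The Markov property at step \<open>j\<close>, for the process whose state is the whole past.\<close>

lemma walk_expectation_prefix:
  assumes "\<eta> \<noteq> []" and "j \<le> n"
  shows "walk_expectation n \<eta> f =
    (\<Sum>\<omega>\<in>paths (last \<eta>) j. path_weight \<eta> j \<omega> * walk_expectation (n - j) (\<eta> \<odot> \<omega>) f)"
  using assms(2)
proof (induction j)
  case 0
  then show ?case by (simp add: concat_path_def)
next
  case (Suc j)
  then have j: "n - j = Suc (n - Suc j)" by simp
  have "walk_expectation n \<eta> f =
    (\<Sum>\<omega>\<in>paths (last \<eta>) j. path_weight \<eta> j \<omega> * walk_expectation (n - j) (\<eta> \<odot> \<omega>) f)"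
    using Suc by simp
  also have "\<dots> = (\<Sum>\<omega>\<in>paths (last \<eta>) (Suc j).
      path_weight \<eta> (Suc j) \<omega> * walk_expectation (n - Suc j) (\<eta> \<odot> \<omega>) f)"
    unfolding sum_paths_Suc j walk_expectation.simps sum_distrib_left
    using assms(1)
    by (intro sum.cong refl)
      (auto simp: path_weight_snoc paths_length paths_nonempty paths_hd last_concat_path concat_path_snoc)
  finally show ?case .
qed

text \<open>Let the walk remember \<open>\<eta>\<close> during its first \<open>j\<close> steps and forget \<open>\<eta>\<close>, but not those steps,
  afterwards. The expectations for \<open>j\<close> and \<open>j + 1\<close> differ only in the kernel that is used for one
  step, and they telescope from the walk without \<open>\<eta>\<close> at \<open>j = 0\<close> to the walk with history \<open>\<eta>\<close>
  at \<open>j = n\<close>.\<close>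

lemma forget_history:
  assumes "\<eta> \<noteq> []"
  shows "walk_expectation n \<eta> f = walk_expectation n [last \<eta>] f +
    (\<Sum>j<n. \<Sum>\<omega>\<in>paths (last \<eta>) (Suc j).
       memory_gap \<eta> j \<omega> * path_weight \<eta> j \<omega> * walk_expectation (n - Suc j) \<omega> f)"
proof -
  define A where "A j = (\<Sum>\<omega>\<in>paths (last \<eta>) j. path_weight \<eta> j \<omega> * walk_expectation (n - j) \<omega> f)" for j
  have step: "A (Suc j) - A j = (\<Sum>\<omega>\<in>paths (last \<eta>) (Suc j).
       memory_gap \<eta> j \<omega> * path_weight \<eta> j \<omega> * walk_expectation (n - Suc j) \<omega> f)" if "j < n" for j
  proof -
    from that have j: "n - j = Suc (n - Suc j)" by simp
    show ?thesis
      unfolding A_def sum_memory_gap sum_paths_Suc j walk_expectation.simps sum_distrib_left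
        sum_subtractf[symmetric]
      by (intro sum.cong refl)
        (auto simp: path_weight_snoc paths_length algebra_simps)
  qed
  have "A n = (\<Sum>\<omega>\<in>paths (last \<eta>) n. path_weight \<eta> n \<omega> * f (last (\<eta> \<odot> \<omega>)))"
    unfolding A_def using assms
    by (intro sum.cong refl) (auto simp: last_concat_path paths_nonempty paths_hd)
  also have "\<dots> = walk_expectation n \<eta> f"
    using walk_expectation_prefix[OF assms, of n n f] by simp
  finally have "walk_expectation n \<eta> f - A 0 = (\<Sum>j<n. A (Suc j) - A j)"
    by (simp add: sum_lessThan_telescope)
  also have "\<dots> = (\<Sum>j<n. \<Sum>\<omega>\<in>paths (last \<eta>) (Suc j).
       memory_gap \<eta> j \<omega> * path_weight \<eta> j \<omega> * walk_expectation (n - Suc j) \<omega> f)"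
    by (intro sum.cong refl step) auto
  finally show ?thesis by (simp add: A_def)
qed

section \<open>The iterated expansion\<close>

text \<open>One summand of the expansion coefficient, belonging to the tuple \<open>(j\<^sub>1, \<dots>, j\<^sub>N)\<close>, integrated against
  a function \<open>g\<close> of the final vertex. The path that has just been traversed is the history
  of the next one.\<close>

primrec expansion_term :: "nat list \<Rightarrow> 'd path \<Rightarrow> ('d point \<Rightarrow> real) \<Rightarrow> real" where
  "expansion_term [] \<eta> g = g (last \<eta>)"
| "expansion_term (j # js) \<eta> g =
    (\<Sum>\<omega>\<in>paths (last \<eta>) (Suc j). memory_gap \<eta> j \<omega> * path_weight \<eta> j \<omega> * expansion_term js \<omega> g)"

lemma expansion_term_add:
  "expansion_term js \<eta> (\<lambda>x. f x + g x) = expansion_term js \<eta> f + expansion_term js \<eta> g"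
  by (induction js arbitrary: \<eta>) (auto simp: algebra_simps sum.distrib)

lemma expansion_term_cmult:
  "expansion_term js \<eta> (\<lambda>x. c * f x) = c * expansion_term js \<eta> f"
  by (induction js arbitrary: \<eta>) (auto simp: algebra_simps sum_distrib_left)

text \<open>In the innermost sum the final step runs over a difference of two probability mass functions, each
  of total mass one.\<close>

lemma expansion_term_const:
  assumes "js \<noteq> []" and "\<eta> \<noteq> []"
  shows "expansion_term js \<eta> (\<lambda>x. c) = 0"
  using assms
proof (induction js arbitrary: \<eta>)
  case (Cons j js)
  show ?case
  proof (cases "js = []")
    case True
    have "(\<Sum>z\<in>R. (pmf (p (\<eta> \<odot> \<omega>)) (last \<omega> + z) - pmf (p \<omega>) (last \<omega> + z)) * c) = 0"
      if "\<omega> \<in> paths (last \<eta>) j" for \<omega>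
    proof -
      have "last (\<eta> \<odot> \<omega>) = last \<omega>"
        using that Cons.prems by (intro last_concat_path) (auto simp: paths_nonempty paths_hd)
      then show ?thesis
        using sum_step_probabilities[of "\<eta> \<odot> \<omega>"] sum_step_probabilities[of \<omega>] that Cons.prems
        by (simp add: sum_subtractf concat_path_nonempty paths_nonempty flip: sum_distrib_right)
    qed
    then show ?thesis
      using True by (simp add: sum_memory_gap del: paths.simps)
  next
    case False
    then show ?thesis
      using Cons.IH paths_nonempty by (simp del: paths.simps)
  qed
qed simp

end

lemma has_sum_finite_sum:
  fixes f :: "'i \<Rightarrow> 'a \<Rightarrow> 'b::topological_comm_monoid_add"
  assumes "\<And>i. i \<in> I \<Longrightarrow> (f i has_sum s i) A"
  shows "((\<lambda>x. \<Sum>i\<in>I. f i x) has_sum (\<Sum>i\<in>I. s i)) A"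
  using assms by (induction I rule: infinite_finite_induct) (auto intro!: has_sum_add has_sum_0)

text \<open>Adding one to each entry of \<open>js\<close> gives a composition of \<open>k\<close>: the lengths \<open>j\<^sub>n + 1\<close> of consecutive
  pieces of a walk of \<open>k\<close> steps. All index sets \<open>\<A>\<^bsub>m,N\<^esub>\<close> with \<open>N \<ge> 1\<close> together are the compositions of
  \<open>m - 1\<close>, for \<open>m \<ge> 2\<close>.\<close>

definition compositions :: "nat \<Rightarrow> nat list set" where
  "compositions k = {js. sum_list js + length js = k}"

lemma compositions_0: "compositions 0 = {[]}"
  by (auto simp: compositions_def)

lemma compositions_Suc: "compositions (Suc k) = (\<Union>j\<le>k. (#) j ` compositions (k - j))"
proof (intro set_eqI iffI)
  fix js assume "js \<in> compositions (Suc k)"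
  then show "js \<in> (\<Union>j\<le>k. (#) j ` compositions (k - j))"
    by (cases js) (auto simp: compositions_def intro!: bexI[where x="hd js"] image_eqI[where x="tl js"])
qed (auto simp: compositions_def)

lemma finite_compositions: "finite (compositions k)"
proof (induction k rule: less_induct)
  case (less k)
  then show ?case
    by (cases k) (auto simp: compositions_0 compositions_Suc)
qed

lemma sum_compositions_Suc:
  "(\<Sum>js\<in>compositions (Suc k). G js) = (\<Sum>j\<le>k. \<Sum>js\<in>compositions (k - j). G (j # js))"
  unfolding compositions_Suc
  by (subst sum.UNION_disjoint) (auto simp: finite_compositions sum.reindex)

context short_range_kernel begin

text \<open>Each error term of \<open>forget_history\<close> ends with a shorter walk whose history is the piece \<open>\<omega>\<close>, so the
  induction hypothesis removes that history as well. Prepending \<open>j\<close> to the compositions for the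
  shorter walk yields the nonempty compositions for the walk of \<open>n\<close> steps; the empty one is the walk
  with no history.\<close>

lemma iterated_expansion:
  assumes "\<eta> \<noteq> []"
  shows "walk_expectation n \<eta> f =
    (\<Sum>k\<le>n. \<Sum>js\<in>compositions k. expansion_term js \<eta> (\<lambda>x. walk_expectation (n - k) [x] f))"
  using assms
proof (induction n arbitrary: \<eta> rule: less_induct)
  case (less n)
  define t where "t j k = (\<Sum>js\<in>compositions k. expansion_term (j # js) \<eta>
     (\<lambda>x. walk_expectation (n - Suc (j + k)) [x] f))" for j k
  have "(\<Sum>\<omega>\<in>paths (last \<eta>) (Suc j).
       memory_gap \<eta> j \<omega> * path_weight \<eta> j \<omega> * walk_expectation (n - Suc j) \<omega> f) =
     (\<Sum>k<n - j. t j k)" if "j < n" for j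
  proof -
    have "(\<Sum>\<omega>\<in>paths (last \<eta>) (Suc j).
        memory_gap \<eta> j \<omega> * path_weight \<eta> j \<omega> * walk_expectation (n - Suc j) \<omega> f) =
      (\<Sum>\<omega>\<in>paths (last \<eta>) (Suc j). \<Sum>k\<le>n - Suc j. \<Sum>js\<in>compositions k.
        memory_gap \<eta> j \<omega> * path_weight \<eta> j \<omega> *
        expansion_term js \<omega> (\<lambda>x. walk_expectation (n - Suc j - k) [x] f))"
    proof (rule sum.cong[OF refl])
      fix \<omega> assume "\<omega> \<in> paths (last \<eta>) (Suc j)"
      then have "\<omega> \<noteq> []" by (rule paths_nonempty)
      then show "memory_gap \<eta> j \<omega> * path_weight \<eta> j \<omega> * walk_expectation (n - Suc j) \<omega> f =
          (\<Sum>k\<le>n - Suc j. \<Sum>js\<in>compositions k. memory_gap \<eta> j \<omega> * path_weight \<eta> j \<omega> *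
             expansion_term js \<omega> (\<lambda>x. walk_expectation (n - Suc j - k) [x] f))"
        using less.IH[of "n - Suc j" \<omega>] that by (simp add: sum_distrib_left)
    qed
    also have "\<dots> = (\<Sum>k\<le>n - Suc j. \<Sum>js\<in>compositions k. \<Sum>\<omega>\<in>paths (last \<eta>) (Suc j).
        memory_gap \<eta> j \<omega> * path_weight \<eta> j \<omega> *
        expansion_term js \<omega> (\<lambda>x. walk_expectation (n - Suc j - k) [x] f))"
      by (subst sum.swap, intro sum.cong refl, subst sum.swap, intro refl)
    also have "\<dots> = (\<Sum>k<n - j. t j k)"
      unfolding t_def using that by (intro sum.cong) auto
    finally show ?thesis .
  qed
  then have "walk_expectation n \<eta> f = walk_expectation n [last \<eta>] f + (\<Sum>j<n. \<Sum>k<n - j. t j k)"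
    using forget_history[OF less.prems, of n f] by simp
  \<comment> \<open>Collect the terms by the total number \<open>Suc (j + k)\<close> of steps used up by the pieces.\<close>
  also have "(\<Sum>j<n. \<Sum>k<n - j. t j k) = (\<Sum>(j, k)\<in>{(j, k). j + k < n}. t j k)"
    by (subst sum.Sigma) (auto intro!: sum.cong)
  also have "\<dots> = (\<Sum>k<n. \<Sum>j\<le>k. t j (k - j))"
    by (rule sum.triangle_reindex)
  also have "\<dots> = (\<Sum>k<n. \<Sum>js\<in>compositions (Suc k).
      expansion_term js \<eta> (\<lambda>x. walk_expectation (n - Suc k) [x] f))"
    unfolding sum_compositions_Suc t_def by (intro sum.cong refl) auto
  finally show ?case
    by (simp only: sum.atMost_shift) (simp add: compositions_0)
qed

section \<open>The coefficients as finite sums\<close>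

text \<open>Before the last step the weight is a product of transition probabilities, and at the last step the
  gap can be nonzero only if one of the two probabilities is; all of these kernels are evaluated at
  a history that ends in the current vertex.\<close>

lemma path_in_range:
  assumes "memory_gap \<eta> j \<omega> * path_weight \<eta> j \<omega> \<noteq> 0" "\<eta> \<noteq> []"
    and "length \<omega> = j + 2" "hd \<omega> = last \<eta>"
  shows "\<omega> \<in> paths (last \<eta>) (Suc j)"
  unfolding in_paths_iff
proof (intro conjI allI impI)
  fix i assume i: "i < Suc j"
  have last_take: "last (take (Suc i) \<omega>) = \<omega> ! i"
    using i assms(3) by (simp add: take_Suc_conv_app_nth)
  have ne: "take (Suc i) \<omega> \<noteq> []"
    using assms(3) by auto
  have last_eq: "last (\<eta> \<odot> take (Suc i) \<omega>) = \<omega> ! i"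
    using last_concat_path[of "take (Suc i) \<omega>" \<eta>] assms ne last_take by simp
  have "pmf (p (\<eta> \<odot> take (Suc i) \<omega>)) (\<omega> ! Suc i) \<noteq> 0 \<or> pmf (p (take (Suc i) \<omega>)) (\<omega> ! Suc i) \<noteq> 0"
  proof (cases "i = j")
    case True
    then show ?thesis using assms(1) by (auto simp: memory_gap_def)
  next
    case False
    then show ?thesis using assms(1) i by (auto simp: path_weight_def)
  qed
  then show "\<omega> ! Suc i - \<omega> ! i \<in> R"
    using step_in_R[of "\<eta> \<odot> take (Suc i) \<omega>"] step_in_R[of "take (Suc i) \<omega>"] ne last_take last_eq
    by (metis concat_path_nonempty[OF assms(2)])
qed (use assms in auto)

text \<open>The tuples \<open>(\<omega>\<^sup>(\<^sup>1\<^sup>), \<dots>, \<omega>\<^sup>(\<^sup>N\<^sup>))\<close> with steps in \<open>R\<close>, where \<open>\<eta>\<close> takes the place of the preceding path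
  \<open>\<omega>\<^sup>(\<^sup>0\<^sup>)\<close>. The recursion matches that of \<open>expansion_term\<close>.\<close>

primrec tuples :: "nat list \<Rightarrow> 'd path \<Rightarrow> 'd path list set" where
  "tuples [] \<eta> = {[]}"
| "tuples (j # js) \<eta> = (\<Union>\<omega>\<in>paths (last \<eta>) (Suc j). (#) \<omega> ` tuples js \<omega>)"

lemma finite_tuples: "finite (tuples js \<eta>)"
  by (induction js arbitrary: \<eta>) (auto simp: finite_paths simp del: paths.simps)

definition tuple_weight :: "nat list \<Rightarrow> 'd path \<Rightarrow> 'd path list \<Rightarrow> real" where
  "tuple_weight js \<eta> ws = (\<Prod>n<length js.
     memory_gap ((\<eta> # ws) ! n) (js ! n) (ws ! n) * path_weight ((\<eta> # ws) ! n) (js ! n) (ws ! n))"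

lemma tuple_weight_Cons:
  "tuple_weight (j # js) \<eta> (\<omega> # ws) = memory_gap \<eta> j \<omega> * path_weight \<eta> j \<omega> * tuple_weight js \<omega> ws"
  by (simp add: tuple_weight_def prod.lessThan_Suc_shift del: prod.lessThan_Suc)

lemma sum_tuples:
  "(\<Sum>ws\<in>tuples js \<eta>. tuple_weight js \<eta> ws * g (last (last (\<eta> # ws)))) = expansion_term js \<eta> g"
proof (induction js arbitrary: \<eta>)
  case Nil
  then show ?case by (simp add: tuple_weight_def)
next
  case (Cons j js)
  have "(\<Sum>ws\<in>tuples (j # js) \<eta>. tuple_weight (j # js) \<eta> ws * g (last (last (\<eta> # ws)))) =
     (\<Sum>\<omega>\<in>paths (last \<eta>) (Suc j). \<Sum>ws\<in>tuples js \<omega>.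
        tuple_weight (j # js) \<eta> (\<omega> # ws) * g (last (last (\<omega> # ws))))"
    unfolding tuples.simps
    by (subst sum.UNION_disjoint)
      (auto simp: finite_paths finite_tuples sum.reindex simp del: paths.simps)
  also have "\<dots> = expansion_term (j # js) \<eta> g"
    by (simp add: tuple_weight_Cons mult.assoc Cons.IH del: paths.simps last.simps flip: sum_distrib_left)
  finally show ?case .
qed

text \<open>The conditions of \<open>path_tuples\<close> on the paths after the first, without a restriction on the steps:
  the tuples here in general form an infinite set, of which \<open>tuples\<close> is the part that can carry weight.\<close>

definition chained :: "nat list \<Rightarrow> 'd path \<Rightarrow> 'd path list \<Rightarrow> bool" where
  "chained js \<eta> ws \<longleftrightarrow> length ws = length js \<and>
     (\<forall>n<length js. length (ws ! n) = js ! n + 2 \<and> hd (ws ! n) = last ((\<eta> # ws) ! n))"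

lemma chained_Cons:
  "chained (j # js) \<eta> ws \<longleftrightarrow>
     (\<exists>\<omega> ws'. ws = \<omega> # ws' \<and> length \<omega> = j + 2 \<and> hd \<omega> = last \<eta> \<and> chained js \<omega> ws')"
  by (cases ws) (auto simp: chained_def All_less_Suc2)

lemma tuples_chained: "ws \<in> tuples js \<eta> \<Longrightarrow> chained js \<eta> ws"
proof (induction js arbitrary: \<eta> ws)
  case Nil
  then show ?case by (simp add: chained_def)
next
  case (Cons j js)
  then show ?case
    by (auto simp: chained_Cons paths_length paths_hd simp del: paths.simps)
qed

lemma chained_in_tuples:
  assumes "chained js \<eta> ws" "tuple_weight js \<eta> ws \<noteq> 0" "\<eta> \<noteq> []"
  shows "ws \<in> tuples js \<eta>"
  using assms
proof (induction js arbitrary: \<eta> ws)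
  case Nil
  then show ?case by (simp add: chained_def)
next
  case (Cons j js)
  from Cons.prems(1) obtain \<omega> ws' where ws: "ws = \<omega> # ws'"
    and \<omega>: "length \<omega> = j + 2" "hd \<omega> = last \<eta>" "chained js \<omega> ws'"
    by (auto simp: chained_Cons)
  have "\<omega> \<in> paths (last \<eta>) (Suc j)"
    using Cons.prems ws \<omega> by (intro path_in_range) (auto simp: tuple_weight_Cons)
  moreover have "ws' \<in> tuples js \<omega>"
    using Cons.prems ws \<omega> by (intro Cons.IH) (auto simp: tuple_weight_Cons)
  ultimately show ?case by (auto simp: ws simp del: paths.simps)
qed

lemma path_tuples_iff:
  "ws \<in> path_tuples js \<longleftrightarrow> (\<exists>z ws'. ws = [0, z] # ws' \<and> chained js [0, z] ws')"
proof (cases ws)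
  case Nil
  then show ?thesis by (auto simp: path_tuples_def)
next
  case (Cons \<omega> ws')
  have "ws \<in> path_tuples js \<longleftrightarrow> length \<omega> = 2 \<and> hd \<omega> = 0 \<and> chained js \<omega> ws'"
  proof -
    have le: "(\<forall>n\<le>length js. P n) \<longleftrightarrow> P 0 \<and> (\<forall>n<length js. P (Suc n))" for P
      unfolding less_Suc_eq_le[symmetric] by (rule All_less_Suc2)
    have ge_1: "(\<forall>n\<in>{1..length js}. P n) \<longleftrightarrow> (\<forall>n<length js. P (Suc n))" for P
      by (auto simp: Suc_le_eq) (metis Suc_le_eq Suc_pred)
    show ?thesis
      unfolding path_tuples_def chained_def Cons le ge_1 mem_Collect_eq
      by (auto simp: idx_def numeral_2_eq_2)
  qed
  also have "\<dots> \<longleftrightarrow> (\<exists>z. \<omega> = [0, z] \<and> chained js \<omega> ws')"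
    by (auto simp: length_Suc_conv numeral_2_eq_2)
  finally show ?thesis using Cons by auto
qed

text \<open>Outside the finite set of tuples with steps in \<open>R\<close> every summand vanishes, and on it the indexed
  products are those of \<open>tuple_weight\<close>.\<close>

lemma infsum_path_tuples:
  "(\<Sum>\<^sub>\<infinity>ws\<in>path_tuples js.
      of_bool (ws ! length js ! Suc (idx js (length js)) = y) * D p (ws ! 0 ! 1) *
      (\<Prod>n=1..length js. \<Delta> p js ws n *
         (\<Prod>i<idx js n. pmf (p (ws ! (n - 1) \<odot> take (Suc i) (ws ! n))) (ws ! n ! Suc i)))) =
   (\<Sum>z\<in>R. D p z * expansion_term js [0, z] (\<lambda>x. of_bool (x = y)))"
proof -
  define F where "F ws = of_bool (ws ! length js ! Suc (idx js (length js)) = y) * D p (ws ! 0 ! 1) *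
      (\<Prod>n=1..length js. \<Delta> p js ws n *
         (\<Prod>i<idx js n. pmf (p (ws ! (n - 1) \<odot> take (Suc i) (ws ! n))) (ws ! n ! Suc i)))" for ws
  define S where "S = (\<Union>z\<in>R. (#) [0, z] ` tuples js [0, z])"
  have F: "F ([0, z] # ws) = D p z * (tuple_weight js [0, z] ws * of_bool (last (last ([0, z] # ws)) = y))"
    if "chained js [0, z] ws" for z ws
  proof -
    let ?ws = "[0, z] # ws"
    have "?ws ! length js = last ?ws"
      using that by (subst last_conv_nth) (auto simp: chained_def)
    moreover have "length (?ws ! length js) = idx js (length js) + 2"
      using that by (cases "length js") (auto simp: chained_def idx_def)
    ultimately have end_pt: "?ws ! length js ! Suc (idx js (length js)) = last (last ?ws)"
      using last_conv_nth[of "last ?ws"] by (cases "last ?ws = []") auto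
    have "(\<Prod>n=1..length js. \<Delta> p js ?ws n *
         (\<Prod>i<idx js n. pmf (p (?ws ! (n - 1) \<odot> take (Suc i) (?ws ! n))) (?ws ! n ! Suc i))) =
       tuple_weight js [0, z] ws"
      unfolding tuple_weight_def One_nat_def prod.atLeast_Suc_atMost_Suc_shift
        atLeast0AtMost
      by (simp add: prod.atLeast1_atMost_eq \<Delta>_def memory_gap_def path_weight_def idx_def Let_def)
    with end_pt show ?thesis by (simp add: F_def)
  qed
  have "infsum F (path_tuples js) = infsum F S"
  proof (rule infsum_cong_neutral)
    fix ws assume "ws \<in> path_tuples js - S"
    then obtain z ws' where ws: "ws = [0, z] # ws'" "chained js [0, z] ws'" "ws \<notin> S"
      by (auto simp: path_tuples_iff)
    show "F ws = 0"
    proof (rule ccontr)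
      assume "F ws \<noteq> 0"
      then have "D p z \<noteq> 0" "tuple_weight js [0, z] ws' \<noteq> 0"
        using F[OF ws(2)] ws(1) by auto
      then have "z \<in> R" "ws' \<in> tuples js [0, z]"
        using step_in_R[of "[0]" z] chained_in_tuples[OF ws(2)] by (auto simp: D_def)
      then show False using ws by (auto simp: S_def)
    qed
  next
    fix ws assume "ws \<in> S - path_tuples js"
    then show "F ws = 0"
      by (auto simp: S_def path_tuples_iff dest: tuples_chained)
  qed auto
  also have "\<dots> = sum F S"
    by (simp add: S_def finite_R finite_tuples)
  also have "\<dots> = (\<Sum>z\<in>R. \<Sum>ws\<in>tuples js [0, z]. F ([0, z] # ws))"
    unfolding S_def
    by (subst sum.UNION_disjoint) (auto simp: finite_R finite_tuples sum.reindex)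
  also have "\<dots> = (\<Sum>z\<in>R. \<Sum>ws\<in>tuples js [0, z].
      D p z * (tuple_weight js [0, z] ws * of_bool (last (last ([0, z] # ws)) = y)))"
    by (intro sum.cong refl F) (auto dest: tuples_chained)
  also have "\<dots> = (\<Sum>z\<in>R. D p z * expansion_term js [0, z] (\<lambda>x. of_bool (x = y)))"
    unfolding sum_distrib_left[symmetric] by (subst sum_tuples) simp
  finally show ?thesis unfolding F_def .
qed

text \<open>This is \<open>\<Sum>\<^sub>y g(y) \<pi>\<^sub>m(y)\<close> for \<open>m \<ge> 2\<close>, see \<open>has_sum_\<pi>\<close>; written in this form it is visibly a linear
  functional of \<open>g\<close> and of the shape that the expansion produces.\<close>

definition expansion_moment :: "nat \<Rightarrow> ('d point \<Rightarrow> real) \<Rightarrow> real" where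
  "expansion_moment m g =
     (\<Sum>z\<in>R. D p z * (\<Sum>js\<in>compositions (m - 1). expansion_term js [0, z] g))"

lemma expansion_moment_add:
  "expansion_moment m (\<lambda>x. f x + g x) = expansion_moment m f + expansion_moment m g"
  by (simp add: expansion_moment_def expansion_term_add sum.distrib algebra_simps)

lemma expansion_moment_cmult:
  "expansion_moment m (\<lambda>x. c * f x) = c * expansion_moment m f"
  by (simp add: expansion_moment_def expansion_term_cmult sum_distrib_left algebra_simps)

lemma expansion_moment_const:
  assumes "m \<ge> 2"
  shows "expansion_moment m (\<lambda>x. c) = 0"
proof -
  have "expansion_term js [0, z] (\<lambda>x. c) = 0" if "js \<in> compositions (m - 1)" for js z
    using that assms by (intro expansion_term_const) (auto simp: compositions_def)
  then show ?thesis by (simp add: expansion_moment_def)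
qed

lemma \<pi>_eq_expansion_moment:
  assumes "m \<ge> 2"
  shows "\<pi> p m y = expansion_moment m (\<lambda>x. of_bool (x = y))"
proof -
  define G where "G js = (\<Sum>z\<in>R. D p z * expansion_term js [0, z] (\<lambda>x. of_bool (x = y)))" for js
  have \<pi>N: "\<pi>N p N m y = (\<Sum>js\<in>index_set m N. G js)" for N
    unfolding \<pi>N_def
  proof (rule sum.cong[OF refl])
    fix js assume "js \<in> index_set m N"
    then have N: "N = length js" by (simp add: index_set_def)
    show "(\<Sum>\<^sub>\<infinity>ws\<in>path_tuples js.
        of_bool (ws ! N ! Suc (idx js N) = y) * D p (ws ! 0 ! 1) *
        (\<Prod>n=1..N. \<Delta> p js ws n *
           (\<Prod>i<idx js n. pmf (p (ws ! (n - 1) \<odot> take (Suc i) (ws ! n))) (ws ! n ! Suc i)))) = G js"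
      unfolding N G_def by (rule infsum_path_tuples)
  qed
  have finite_index: "finite (index_set m N)" for N
    by (rule finite_subset[OF _ finite_compositions[of "m - 1"]])
      (auto simp: index_set_def compositions_def)
  have "\<pi> p m y = infsum (\<lambda>N. \<pi>N p N m y) {1..<m}"
    unfolding \<pi>_def by (rule infsum_cong_neutral) (auto simp: \<pi>N index_set_def)
  also have "\<dots> = (\<Sum>N\<in>{1..<m}. \<Sum>js\<in>index_set m N. G js)"
    by (simp add: \<pi>N)
  also have "\<dots> = (\<Sum>js\<in>(\<Union>N\<in>{1..<m}. index_set m N). G js)"
    by (subst sum.UNION_disjoint) (auto simp: finite_index, auto simp: index_set_def)
  also have "(\<Union>N\<in>{1..<m}. index_set m N) = compositions (m - 1)"
    using assms by (auto simp: index_set_def compositions_def Suc_le_eq)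
  also have "(\<Sum>js\<in>compositions (m - 1). G js) = expansion_moment m (\<lambda>x. of_bool (x = y))"
    unfolding G_def expansion_moment_def sum_distrib_left by (rule sum.swap)
  finally show ?thesis .
qed

text \<open>The final vertex takes finitely many values, so summing over it decomposes \<open>g\<close> into point masses.\<close>

lemma has_sum_expansion_term:
  "((\<lambda>y. g y * expansion_term js \<eta> (\<lambda>x. of_bool (x = y))) has_sum expansion_term js \<eta> g) UNIV"
proof (induction js arbitrary: \<eta>)
  case Nil
  have "((\<lambda>y. g y * of_bool (last \<eta> = y)) has_sum g (last \<eta>)) UNIV"
    by (rule has_sum_finite_neutralI[where B="{last \<eta>}"]) auto
  then show ?case by simp
next
  case (Cons j js)
  have "((\<lambda>y. \<Sum>\<omega>\<in>paths (last \<eta>) (Suc j). memory_gap \<eta> j \<omega> * path_weight \<eta> j \<omega> *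
      (g y * expansion_term js \<omega> (\<lambda>x. of_bool (x = y)))) has_sum
     (\<Sum>\<omega>\<in>paths (last \<eta>) (Suc j). memory_gap \<eta> j \<omega> * path_weight \<eta> j \<omega> * expansion_term js \<omega> g)) UNIV"
    by (intro has_sum_finite_sum has_sum_cmult_right Cons.IH)
  then show ?case
    by (simp add: sum_distrib_left mult.left_commute del: paths.simps)
qed

lemma has_sum_\<pi>:
  assumes "m \<ge> 2"
  shows "((\<lambda>y. g y * \<pi> p m y) has_sum expansion_moment m g) UNIV"
proof -
  have "((\<lambda>y. \<Sum>z\<in>R. D p z * (\<Sum>js\<in>compositions (m - 1).
      g y * expansion_term js [0, z] (\<lambda>x. of_bool (x = y)))) has_sum expansion_moment m g) UNIV"
    unfolding expansion_moment_def
    by (intro has_sum_finite_sum has_sum_cmult_right has_sum_expansion_term)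
  then show ?thesis
    by (simp add: \<pi>_eq_expansion_moment[OF assms] expansion_moment_def sum_distrib_left mult.left_commute)
qed

section \<open>Recursions for the moments\<close>

lemma walk_expectation_translate:
  assumes "translation_invariant p" "xs \<noteq> []"
  shows "walk_expectation n (map (\<lambda>x. x + v) xs) f = walk_expectation n xs (\<lambda>x. f (x + v))"
  using assms(2)
proof (induction n arbitrary: xs)
  case 0
  then show ?case by (simp add: last_map)
next
  case (Suc n)
  have "pmf (p (map (\<lambda>x. x + v) xs)) (last xs + v + z) = pmf (p xs) (last xs + z)" for z
  proof -
    have "pmf (p (map (\<lambda>x. x + v) xs)) (last xs + z + v) = pmf (p xs) (last xs + z)"
      using assms(1) Suc.prems unfolding translation_invariant_def by blast
    then show ?thesis by (simp add: add_ac)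
  qed
  moreover have "walk_expectation n (map (\<lambda>x. x + v) xs @ [last xs + v + z]) f =
      walk_expectation n (xs @ [last xs + z]) (\<lambda>x. f (x + v))" for z
    using Suc.IH[of "xs @ [last xs + z]"] by (simp add: add_ac)
  ultimately show ?case
    using Suc.prems by (simp add: last_map)
qed

lemma walk_expectation_start:
  assumes "translation_invariant p"
  shows "walk_expectation n [x] f = walk_expectation n [0] (\<lambda>y. f (x + y))"
  using walk_expectation_translate[OF assms, of "[0]" n x f] by (simp add: add.commute)

text \<open>The recursion of the expansion, tested against \<open>f\<close>: condition on the first step and
  expand the rest of the walk with history \<open>(0, z)\<close>. The summation index is \<open>k = m - 2\<close>.\<close>

lemma walk_expectation_recursion:
  "walk_expectation (Suc n) [0] f =
     (\<Sum>z\<in>R. D p z * walk_expectation n [z] f) +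
     (\<Sum>k<n. expansion_moment (k + 2) (\<lambda>x. walk_expectation (n - Suc k) [x] f))"
proof -
  have "walk_expectation n [0, z] f = walk_expectation n [z] f +
    (\<Sum>k<n. \<Sum>js\<in>compositions (Suc k). expansion_term js [0, z] (\<lambda>x. walk_expectation (n - Suc k) [x] f))" for z
    by (subst iterated_expansion) (simp_all add: sum.atMost_shift compositions_0 del: sum.atMost_Suc)
  then have "walk_expectation (Suc n) [0] f = (\<Sum>z\<in>R. D p z * walk_expectation n [z] f) +
     (\<Sum>z\<in>R. \<Sum>k<n. D p z * (\<Sum>js\<in>compositions (Suc k).
        expansion_term js [0, z] (\<lambda>x. walk_expectation (n - Suc k) [x] f)))"
    by (simp add: D_def algebra_simps sum.distrib sum_distrib_left)
  then show ?thesis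
    by (simp add: expansion_moment_def sum_distrib_left sum.swap[of _ R "{..<n}"])
qed

text \<open>The coordinate of a walk started at \<open>x\<close> is that of a walk started at the origin plus a constant,
  and the coefficients annihilate constants.\<close>

lemma coordinate_recursion:
  fixes i :: 'd
  assumes "translation_invariant p"
  defines "X \<equiv> \<lambda>x. real_of_int (x $ i)"
  shows "walk_expectation (Suc n) [0] X =
    walk_expectation n [0] X + (\<Sum>z\<in>R. D p z * X z) + (\<Sum>k<n. expansion_moment (k + 2) X)"
proof -
  define e where "e k = walk_expectation k [0] X" for k
  have start: "walk_expectation k [x] X = X x + e k" for k x
  proof -
    have "walk_expectation k [x] X = walk_expectation k [0] (\<lambda>y. X x + X y)"
      unfolding walk_expectation_start[OF assms(1), of k x] by (simp add: X_def)
    then show ?thesis by (simp add: walk_expectation_add walk_expectation_const e_def)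
  qed
  have "(\<Sum>z\<in>R. D p z * walk_expectation n [z] X) = (\<Sum>z\<in>R. D p z * X z) + (\<Sum>z\<in>R. D p z) * e n"
    unfolding start by (simp add: algebra_simps sum.distrib sum_distrib_left)
  moreover have "(\<Sum>z\<in>R. D p z) = 1"
    using sum_step_probabilities[of "[0]"] by (simp add: D_def)
  moreover have "expansion_moment (k + 2) (\<lambda>x. walk_expectation l [x] X) = expansion_moment (k + 2) X" for k l
    unfolding start expansion_moment_add by (simp add: expansion_moment_const)
  ultimately show ?thesis
    by (subst walk_expectation_recursion) (simp add: e_def)
qed

text \<open>Expanding \<open>(x\<^sub>i + \<omega>\<^sub>i) (x\<^sub>j + \<omega>\<^sub>j)\<close> for a walk started at \<open>x\<close>, the term without \<open>x\<close> is again killed by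
  the coefficients.\<close>

lemma product_recursion:
  fixes i j :: 'd
  assumes "translation_invariant p"
  defines "X \<equiv> \<lambda>x. real_of_int (x $ i)" and "Y \<equiv> \<lambda>x. real_of_int (x $ j)"
  defines "e \<equiv> \<lambda>n. walk_expectation n [0] X" and "e' \<equiv> \<lambda>n. walk_expectation n [0] Y"
  shows "walk_expectation (Suc n) [0] (\<lambda>x. X x * Y x) =
    walk_expectation n [0] (\<lambda>x. X x * Y x) + (\<Sum>z\<in>R. D p z * (X z * Y z)) +
    (\<Sum>z\<in>R. D p z * X z) * e' n + (\<Sum>z\<in>R. D p z * Y z) * e n +
    (\<Sum>k<n. expansion_moment (k + 2) (\<lambda>x. X x * Y x) +
       expansion_moment (k + 2) X * e' (n - Suc k) + expansion_moment (k + 2) Y * e (n - Suc k))"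
proof -
  define q where "q k = walk_expectation k [0] (\<lambda>x. X x * Y x)" for k
  have start: "walk_expectation k [x] (\<lambda>x. X x * Y x) =
      (X x * Y x + (e' k * X x + e k * Y x)) + q k" for k x
  proof -
    have "walk_expectation k [x] (\<lambda>x. X x * Y x) =
       walk_expectation k [0] (\<lambda>y. X x * Y x + (X x * Y y + (Y x * X y + X y * Y y)))"
      unfolding walk_expectation_start[OF assms(1), of k x] X_def Y_def by (simp add: algebra_simps)
    also have "\<dots> = X x * Y x + (X x * e' k + (Y x * e k + q k))"
      unfolding walk_expectation_add walk_expectation_cmult
      by (simp add: walk_expectation_const e_def e'_def q_def)
    finally show ?thesis by simp
  qed
  have moment: "expansion_moment (k + 2) (\<lambda>x. walk_expectation l [x] (\<lambda>x. X x * Y x)) =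
      expansion_moment (k + 2) (\<lambda>x. X x * Y x) +
      expansion_moment (k + 2) X * e' l + expansion_moment (k + 2) Y * e l" for k l
    unfolding start expansion_moment_add expansion_moment_cmult
    by (simp add: expansion_moment_const)
  have "(\<Sum>z\<in>R. D p z * walk_expectation n [z] (\<lambda>x. X x * Y x)) =
     (\<Sum>z\<in>R. D p z * (X z * Y z)) + (\<Sum>z\<in>R. D p z * X z) * e' n + (\<Sum>z\<in>R. D p z * Y z) * e n +
     (\<Sum>z\<in>R. D p z) * q n"
    unfolding start by (simp add: algebra_simps sum.distrib sum_distrib_left)
  moreover have "(\<Sum>z\<in>R. D p z) = 1"
    using sum_step_probabilities[of "[0]"] by (simp add: D_def)
  ultimately show ?thesis
    unfolding walk_expectation_recursion moment by (simp add: q_def)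
qed

end

section \<open>Limits of sequences with summable memory\<close>

text \<open>The Stolz--Cesaro theorem with denominators \<open>n\<close>: averaged increments have the same limit.\<close>

lemma stolz_cesaro:
  fixes u :: "nat \<Rightarrow> real"
  assumes "(\<lambda>n. u (Suc n) - u n) \<longlonglongrightarrow> l"
  shows "(\<lambda>n. u n / real n) \<longlonglongrightarrow> l"
proof (rule LIMSEQ_I)
  fix e :: real assume e: "e > 0"
  then obtain N where N: "\<bar>u (Suc n) - u n - l\<bar> < e / 2" if "n \<ge> N" for n
    using LIMSEQ_D[OF assms, of "e / 2"] by auto
  define C where "C = \<bar>u N - real N * l\<bar>"
  have bound: "\<bar>u n - real n * l\<bar> \<le> C + (real n - real N) * (e / 2)" if "n \<ge> N" for n
    using that
  proof (induction n rule: dec_induct)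
    case (step n)
    have "real (Suc n) * l = real n * l + l" "(real (Suc n) - real N) * (e / 2) = (real n - real N) * (e / 2) + e / 2"
      by (simp_all add: field_simps)
    then show ?case using step.IH N[of n] step.hyps by linarith
  qed (simp add: C_def)
  \<comment> \<open>Beyond \<open>M\<close> the constant \<open>C\<close> contributes less than \<open>e / 2\<close> to the quotient.\<close>
  obtain M :: nat where M: "2 * C / e < real M"
    using reals_Archimedean2 by blast
  show "\<exists>no. \<forall>n\<ge>no. norm (u n / real n - l) < e"
  proof (intro exI allI impI)
    fix n assume n: "n \<ge> max (Suc N) M"
    then have n_pos: "real n > 0" by simp
    have "2 * C < e * real n"
      using M n e by (simp add: divide_less_eq mult.commute) (smt (verit) mult_left_mono of_nat_mono)
    moreover have "(real n - real N) * (e / 2) \<le> real n * (e / 2)"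
      using e by (intro mult_right_mono) auto
    ultimately have "\<bar>u n - real n * l\<bar> < real n * e"
      using bound[of n] n by (simp add: mult.commute)
    moreover have "u n / real n - l = (u n - real n * l) / real n"
      using n_pos by (simp add: field_simps)
    ultimately show "norm (u n / real n - l) < e"
      using n_pos by (simp add: abs_divide divide_less_eq mult.commute)
  qed
qed

text \<open>Over a lag of \<open>k + 1\<close> steps \<open>e\<close> moves by at most \<open>k + 1\<close> times the bound on its increments, so
  the weighted summability of \<open>a\<close> is what dominated convergence (Tannery) requires.\<close>

lemma tendsto_convolution_lag:
  fixes a e :: "nat \<Rightarrow> real"
  assumes a: "summable (\<lambda>k. real (Suc k) * \<bar>a k\<bar>)"
    and e: "(\<lambda>n. e (Suc n) - e n) \<longlonglongrightarrow> \<theta>"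
  shows "(\<lambda>n. \<Sum>k<n. a k * (e n - e (n - Suc k))) \<longlonglongrightarrow> (\<Sum>k. a k * (real (Suc k) * \<theta>))"
proof -
  obtain B where B: "\<bar>e (Suc n) - e n\<bar> \<le> B" for n
    using convergent_imp_Bseq[OF convergentI[OF e]] unfolding Bseq_def by auto
  have lag_bound: "\<bar>e n - e (n - k)\<bar> \<le> real k * B" if "k \<le> n" for n k
    using that
  proof (induction k)
    case (Suc k)
    then have "n - k = Suc (n - Suc k)" by simp
    moreover have "real (Suc k) * B = real k * B + B" by (simp add: algebra_simps)
    ultimately show ?case using Suc B[of "n - Suc k"] by (smt (verit) Suc_leD)
  qed simp
  have lag_limit: "(\<lambda>n. e n - e (n - k)) \<longlonglongrightarrow> real k * \<theta>" for k
  proof -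
    have "(\<lambda>n. e (n + k) - e n) \<longlonglongrightarrow> real k * \<theta>"
    proof (induction k)
      case (Suc k)
      have "(\<lambda>n. (e (Suc (n + k)) - e (n + k)) + (e (n + k) - e n)) \<longlonglongrightarrow> \<theta> + real k * \<theta>"
        by (intro tendsto_add Suc LIMSEQ_ignore_initial_segment[OF e])
      then show ?case by (simp add: algebra_simps)
    qed simp
    then have "(\<lambda>n. e (n + k) - e (n + k - k)) \<longlonglongrightarrow> real k * \<theta>" by simp
    then show ?thesis by (rule LIMSEQ_offset)
  qed
  define h where "h k n = (if k < n then a k * (e n - e (n - Suc k)) else 0)" for k n
  have "(\<lambda>n. \<Sum>k. h k n) \<longlonglongrightarrow> (\<Sum>k. a k * (real (Suc k) * \<theta>))"
  proof (rule tannerys_theorem[THEN conjunct2, THEN conjunct2])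
    show "(h k) \<longlonglongrightarrow> a k * (real (Suc k) * \<theta>)" for k
    proof (rule Lim_transform_eventually)
      show "(\<lambda>n. a k * (e n - e (n - Suc k))) \<longlonglongrightarrow> a k * (real (Suc k) * \<theta>)"
        by (intro tendsto_mult tendsto_const lag_limit)
      show "\<forall>\<^sub>F n in sequentially. a k * (e n - e (n - Suc k)) = h k n"
        using eventually_gt_at_top[of k] by eventually_elim (simp add: h_def)
    qed
    have "norm (h k n) \<le> real (Suc k) * \<bar>a k\<bar> * B" for k n
    proof (cases "k < n")
      case True
      then have "\<bar>a k\<bar> * \<bar>e n - e (n - Suc k)\<bar> \<le> \<bar>a k\<bar> * (real (Suc k) * B)"
        by (intro mult_left_mono lag_bound) auto
      then show ?thesis using True by (simp add: h_def abs_mult mult_ac)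
    next
      case False
      have "B \<ge> 0" using B[of 0] by linarith
      then show ?thesis using False by (simp add: h_def)
    qed
    then show "\<forall>\<^sub>F (k, n) in sequentially \<times>\<^sub>F sequentially. norm (h k n) \<le> real (Suc k) * \<bar>a k\<bar> * B"
      by (intro always_eventually) auto
    show "summable (\<lambda>k. real (Suc k) * \<bar>a k\<bar> * B)"
      by (intro summable_mult2 a)
  qed simp
  moreover have "(\<Sum>k. h k n) = (\<Sum>k<n. a k * (e n - e (n - Suc k)))" for n
    by (subst suminf_finite[of "{..<n}"]) (auto simp: h_def)
  ultimately show ?thesis by simp
qed

text \<open>The increments converge because \<open>a\<close> is summable; their limit is then also the limit of \<open>e n / n\<close>.\<close>

lemma increment_limit:
  fixes a e :: "nat \<Rightarrow> real"
  assumes rec: "\<And>n. e (Suc n) = e n + d + (\<Sum>k<n. a k)"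
    and a: "summable (\<lambda>k. real (Suc k) * \<bar>a k\<bar>)"
    and lim: "(\<lambda>n. e n / real n) \<longlonglongrightarrow> \<theta>"
  shows "(\<lambda>n. e (Suc n) - e n) \<longlonglongrightarrow> \<theta>"
proof -
  have "summable a"
    by (rule summable_comparison_test'[OF a, of 0]) (simp add: mult_le_cancel_right1)
  then have "(\<lambda>n. d + (\<Sum>k<n. a k)) \<longlonglongrightarrow> d + suminf a"
    by (intro tendsto_add tendsto_const summable_LIMSEQ)
  then have "(\<lambda>n. e (Suc n) - e n) \<longlonglongrightarrow> d + suminf a"
    by (simp add: rec)
  moreover from stolz_cesaro[OF this] lim have "d + suminf a = \<theta>"
    by (rule LIMSEQ_unique)
  ultimately show ?thesis by simp
qed

text \<open>In the increment of \<open>q n - e n * e' n\<close> all terms that grow with \<open>n\<close> appear as differences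
  \<open>e n - e (n - Suc k)\<close>, which stay bounded for fixed \<open>k\<close>. Here \<open>k\<close> stands for \<open>m - 2\<close>, so
  \<open>Suc k\<close> is the factor \<open>m - 1\<close>.\<close>

lemma variance_limit:
  fixes a a' s e e' q :: "nat \<Rightarrow> real"
  assumes e: "\<And>n. e (Suc n) = e n + d + (\<Sum>k<n. a k)"
    and e': "\<And>n. e' (Suc n) = e' n + d' + (\<Sum>k<n. a' k)"
    and q: "\<And>n. q (Suc n) = q n + S + d * e' n + d' * e n +
              (\<Sum>k<n. s k + a k * e' (n - Suc k) + a' k * e (n - Suc k))"
    and a: "summable (\<lambda>k. real (Suc k) * \<bar>a k\<bar>)"
    and a': "summable (\<lambda>k. real (Suc k) * \<bar>a' k\<bar>)"
    and s: "summable s"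
    and e_lim: "(\<lambda>n. e n / real n) \<longlonglongrightarrow> \<theta>"
    and e'_lim: "(\<lambda>n. e' n / real n) \<longlonglongrightarrow> \<theta>'"
  shows "(\<lambda>n. (q n - e n * e' n) / real n) \<longlonglongrightarrow>
    S - \<theta> * \<theta>' - (\<Sum>k. \<theta> * real (Suc k) * a' k + \<theta>' * real (Suc k) * a k - s k)"
proof -
  note inc = increment_limit[OF e a e_lim] increment_limit[OF e' a' e'_lim]
  have summable_lag: "summable (\<lambda>k. b k * (real (Suc k) * t))"
    if "summable (\<lambda>k. real (Suc k) * \<bar>b k\<bar>)" for b :: "nat \<Rightarrow> real" and t
  proof -
    have "summable (\<lambda>k. real (Suc k) * b k)"
      by (rule summable_comparison_test'[OF that, of 0]) (simp add: abs_mult)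
    then have "summable (\<lambda>k. real (Suc k) * b k * t)" by (rule summable_mult2)
    then show ?thesis by (simp add: mult_ac)
  qed
  have eq: "q (Suc n) - e (Suc n) * e' (Suc n) - (q n - e n * e' n) =
     S - (e (Suc n) - e n) * (e' (Suc n) - e' n) + (\<Sum>k<n. s k)
       - (\<Sum>k<n. a k * (e' n - e' (n - Suc k))) - (\<Sum>k<n. a' k * (e n - e (n - Suc k)))" for n
    unfolding q e e' by (simp add: algebra_simps sum.distrib sum_subtractf sum_distrib_left)
  have "(\<lambda>n. q (Suc n) - e (Suc n) * e' (Suc n) - (q n - e n * e' n)) \<longlonglongrightarrow>
     S - \<theta> * \<theta>' + suminf s - (\<Sum>k. a k * (real (Suc k) * \<theta>')) - (\<Sum>k. a' k * (real (Suc k) * \<theta>))"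
    unfolding eq
    by (intro tendsto_diff tendsto_add tendsto_mult tendsto_const inc summable_LIMSEQ s
      tendsto_convolution_lag a a')
  also have "S - \<theta> * \<theta>' + suminf s - (\<Sum>k. a k * (real (Suc k) * \<theta>')) - (\<Sum>k. a' k * (real (Suc k) * \<theta>)) =
    S - \<theta> * \<theta>' - (\<Sum>k. a' k * (real (Suc k) * \<theta>) + a k * (real (Suc k) * \<theta>') - s k)"
    by (simp add: summable_lag a a' s suminf_add[symmetric] suminf_diff[symmetric] summable_add
        del: of_nat_Suc)
  finally show ?thesis
    by (intro stolz_cesaro) (simp add: mult_ac)
qed

section \<open>Expectations under the law of the walk\<close>

text \<open>Off the event \<open>|X\<^sub>n - c| > r / 2\<close> the error is at most \<open>r / 2\<close>; on it, the error is bounded and the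
  probability tends to zero.\<close>

lemma (in prob_space) bounded_convergence_in_prob:
  fixes X :: "nat \<Rightarrow> 'a \<Rightarrow> real"
  assumes meas [measurable]: "\<And>n. X n \<in> borel_measurable M"
    and bound: "\<And>n. AE w in M. \<bar>X n w\<bar> \<le> C"
    and conv: "converges_in_prob M X c"
  shows "(\<lambda>n. \<integral>w. X n w \<partial>M) \<longlonglongrightarrow> c"
proof (rule LIMSEQ_I)
  fix r :: real assume "r > 0"
  define K where "K = \<bar>C\<bar> + \<bar>c\<bar> + 1"
  have K: "K > 0" by (simp add: K_def)
  define A where "A n = {w \<in> space M. dist (X n w) c > r / 2}" for n
  have A [measurable]: "A n \<in> sets M" for n
    unfolding A_def by measurable
  have "(\<lambda>n. prob (A n)) \<longlonglongrightarrow> 0"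
    unfolding A_def using \<open>r > 0\<close> by (intro conv[unfolded converges_in_prob_def, rule_format]) simp
  then obtain N where N: "prob (A n) < r / (2 * K)" if "n \<ge> N" for n
    using LIMSEQ_D[of "\<lambda>n. prob (A n)" 0 "r / (2 * K)"] \<open>r > 0\<close> K by auto
  show "\<exists>no. \<forall>n\<ge>no. norm ((\<integral>w. X n w \<partial>M) - c) < r"
  proof (intro exI allI impI)
    fix n assume "n \<ge> N"
    have int: "integrable M (X n)"
      by (rule integrable_const_bound[where B=C]) (use bound in auto)
    have "norm ((\<integral>w. X n w \<partial>M) - c) = norm (\<integral>w. X n w - c \<partial>M)"
      using int by (simp add: prob_space)
    also have "\<dots> \<le> (\<integral>w. norm (X n w - c) \<partial>M)"
      by (rule integral_norm_bound)
    also have "\<dots> \<le> (\<integral>w. r / 2 + K * indicator (A n) w \<partial>M)"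
    proof (rule integral_mono_AE)
      show "integrable M (\<lambda>w. norm (X n w - c))" using int by simp
      show "integrable M (\<lambda>w. r / 2 + K * indicator (A n) w)"
        by (intro Bochner_Integration.integrable_add integrable_const integrable_mult_right
            integrable_real_indicator) (auto simp: emeasure_eq_measure)
      show "AE w in M. norm (X n w - c) \<le> r / 2 + K * indicator (A n) w"
        using bound[of n] AE_space
      proof eventually_elim
        case (elim w)
        then show ?case
          using \<open>r > 0\<close> by (auto simp: A_def K_def dist_real_def indicator_def)
      qed
    qed
    also have "\<dots> = r / 2 + K * prob (A n)"
      by (simp add: prob_space emeasure_eq_measure)
    also have "\<dots> < r"
      using N[OF \<open>n \<ge> N\<close>] K by (simp add: field_simps)
    finally show "norm ((\<integral>w. X n w \<partial>M) - c) < r" .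
  qed
qed

lemma converges_in_prob_component:
  fixes X :: "nat \<Rightarrow> 'a \<Rightarrow> real ^ 'd"
  assumes "prob_space M" and meas [measurable]: "\<And>n. X n \<in> borel_measurable M"
    and conv: "converges_in_prob M X c"
  shows "converges_in_prob M (\<lambda>n w. X n w $ i) (c $ i)"
  unfolding converges_in_prob_def
proof (intro allI impI)
  interpret prob_space M by fact
  fix \<epsilon> :: real assume "\<epsilon> > 0"
  then have lim: "(\<lambda>n. prob {w \<in> space M. dist (X n w) c > \<epsilon>}) \<longlonglongrightarrow> 0"
    using conv by (auto simp: converges_in_prob_def)
  have "prob {w \<in> space M. dist (X n w $ i) (c $ i) > \<epsilon>} \<le> prob {w \<in> space M. dist (X n w) c > \<epsilon>}" for n
  proof (rule finite_measure_mono)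
    show "{w \<in> space M. dist (X n w $ i) (c $ i) > \<epsilon>} \<subseteq> {w \<in> space M. dist (X n w) c > \<epsilon>}"
      using dist_vec_nth_le[of _ i c] order_less_le_trans by blast
  qed measurable
  then show "(\<lambda>n. prob {w \<in> space M. dist (X n w $ i) (c $ i) > \<epsilon>}) \<longlonglongrightarrow> 0"
    by (intro tendsto_sandwich[OF _ _ tendsto_const lim]) auto
qed

locale short_range_walk = short_range_kernel p R + prob_space Q
  for p :: "'d::finite kernel" and R :: "'d point set" and Q :: "(nat \<Rightarrow> 'd point) measure" +
  assumes walk_law: "walk_law p Q"
begin

lemma sets_Q: "sets Q = sets (Pi\<^sub>M UNIV (\<lambda>_. count_space UNIV))"
  using walk_law by (simp add: walk_law_def)

lemma space_Q: "space Q = UNIV"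
  using sets_eq_imp_space_eq[OF sets_Q] by (simp add: space_PiM)

lemma measurable_position [measurable]: "(\<lambda>w. w n) \<in> Q \<rightarrow>\<^sub>M count_space UNIV"
  unfolding measurable_cong_sets[OF sets_Q refl] by (rule measurable_component_singleton) simp

lemma measurable_function_of_position: "(\<lambda>w. f (w n)) \<in> Q \<rightarrow>\<^sub>M N" if "\<And>x. f x \<in> space N"
  by (rule measurable_compose[OF measurable_position]) (use that in auto)

definition cylinder :: "nat \<Rightarrow> 'd path \<Rightarrow> (nat \<Rightarrow> 'd point) set" where
  "cylinder n xs = {w. map w [0..<Suc n] = xs}"

lemma cylinder_measurable [measurable]: "cylinder n xs \<in> sets Q"
proof -
  have "cylinder n xs = {w \<in> space Q. length xs = Suc n \<and> (\<forall>i\<in>{..n}. w i = xs ! i)}"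
    by (auto simp: cylinder_def space_Q list_eq_iff_nth_eq less_Suc_eq_le simp del: upt_Suc)
  also have "\<dots> \<in> sets Q" by measurable
  finally show ?thesis .
qed

lemma prob_cylinder:
  assumes "xs \<in> paths 0 n"
  shows "prob (cylinder n xs) = path_weight [0] n xs"
proof -
  have xs: "length xs = Suc n" "hd xs = 0" "xs \<noteq> []"
    using assms by (auto simp: paths_length paths_hd paths_nonempty)
  then have "xs ! 0 = 0" by (simp add: hd_conv_nth)
  with xs have "prob (cylinder n xs) = (\<Prod>i<n. pmf (p (take (Suc i) xs)) (xs ! Suc i))"
    using walk_law unfolding walk_law_def cylinder_def by (simp add: space_Q del: upt_Suc)
  moreover have "[0] \<odot> take (Suc i) xs = take (Suc i) xs" for i
    using xs by (cases xs) (auto simp: concat_path_def)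
  ultimately show ?thesis by (simp add: path_weight_def)
qed

text \<open>The cylinders of the finitely many paths with steps in \<open>R\<close> already have total mass one, so no other
  trajectory matters.\<close>

lemma AE_path: "AE w in Q. map w [0..<Suc n] \<in> paths 0 n"
proof -
  have disjoint: "disjoint_family_on (cylinder n) (paths 0 n)"
    by (auto simp: disjoint_family_on_def cylinder_def)
  have "prob (\<Union>xs\<in>paths 0 n. cylinder n xs) = (\<Sum>xs\<in>paths 0 n. prob (cylinder n xs))"
    by (rule finite_measure_finite_Union) (auto simp: finite_paths disjoint)
  also have "\<dots> = (\<Sum>xs\<in>paths 0 n. path_weight [0] n xs)"
    by (intro sum.cong refl prob_cylinder)
  also have "\<dots> = 1"
    using walk_expectation_prefix[of "[0]" n n "\<lambda>_. 1"] by (simp add: walk_expectation_const)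
  finally have "AE w in Q. w \<in> (\<Union>xs\<in>paths 0 n. cylinder n xs)"
    by (rule AE_prob_1)
  then show ?thesis
    by eventually_elim (auto simp: cylinder_def)
qed

lemma integral_position: "(\<integral>w. f (w n) \<partial>Q) = walk_expectation n [0] f"
proof -
  have "(\<integral>w. f (w n) \<partial>Q) = (\<integral>w. (\<Sum>xs\<in>paths 0 n. f (last xs) * indicator (cylinder n xs) w) \<partial>Q)"
  proof (rule integral_cong_AE)
    show "AE w in Q. f (w n) = (\<Sum>xs\<in>paths 0 n. f (last xs) * indicator (cylinder n xs) w)"
      using AE_path[of n]
    proof eventually_elim
      case (elim w)
      have "(\<Sum>xs\<in>paths 0 n. f (last xs) * indicator (cylinder n xs) w) =
         (\<Sum>xs\<in>{map w [0..<Suc n]}. f (last xs) * indicator (cylinder n xs) w)"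
        using elim by (intro sum.mono_neutral_right) (auto simp: finite_paths cylinder_def)
      also have "\<dots> = f (w n)" by (simp add: cylinder_def)
      finally show ?case by simp
    qed
    show "(\<lambda>w. f (w n)) \<in> borel_measurable Q"
      by (rule measurable_function_of_position) simp
    show "(\<lambda>w. \<Sum>xs\<in>paths 0 n. f (last xs) * indicator (cylinder n xs) w) \<in> borel_measurable Q"
      by measurable
  qed
  also have "\<dots> = (\<Sum>xs\<in>paths 0 n. f (last xs) * prob (cylinder n xs))"
    by (subst Bochner_Integration.integral_sum) (auto simp: emeasure_eq_measure space_Q)
  also have "\<dots> = (\<Sum>xs\<in>paths (last [0]) n. path_weight [0] n xs * walk_expectation (n - n) ([0] \<odot> xs) f)"
  proof (rule sum.cong)
    fix xs assume "xs \<in> paths (last [0]) n"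
    then have "xs \<in> paths 0 n" "last ([0] \<odot> xs) = last xs"
      using last_concat_path[of xs "[0]"] by (auto simp: paths_hd paths_nonempty)
    then show "f (last xs) * prob (cylinder n xs) =
        path_weight [0] n xs * walk_expectation (n - n) ([0] \<odot> xs) f"
      by (simp add: prob_cylinder)
  qed simp
  also have "\<dots> = walk_expectation n [0] f"
    by (rule walk_expectation_prefix[symmetric]) auto
  finally show ?thesis .
qed

lemma norm_path_end_le:
  assumes "\<And>z. z \<in> R \<Longrightarrow> norm (rvec z) \<le> L" and "xs \<in> paths 0 n"
  shows "norm (rvec (last xs)) \<le> real n * L"
  using assms(2)
proof (induction n arbitrary: xs)
  case 0
  then show ?case by (simp add: rvec_def vec_eq_iff flip: zero_vec_def)
next
  case (Suc n)
  then obtain \<omega> z where xs: "xs = \<omega> @ [last \<omega> + z]" "\<omega> \<in> paths 0 n" "z \<in> R" by auto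
  have "rvec (last \<omega> + z) = rvec (last \<omega>) + rvec z"
    by (simp add: rvec_def vec_eq_iff)
  then have "norm (rvec (last xs)) \<le> norm (rvec (last \<omega>)) + norm (rvec z)"
    using xs(1) norm_triangle_ineq by simp
  then show ?case
    using Suc.IH[OF xs(2)] assms(1)[OF xs(3)] by (simp add: algebra_simps)
qed

text \<open>The rescaled position is bounded by the range of the steps, so its convergence in
  probability carries over to expectations.\<close>

lemma mean_velocity:
  assumes R: "\<And>z. z \<in> R \<Longrightarrow> norm (rvec z) \<le> L"
    and conv: "converges_in_prob Q (\<lambda>n w. rvec (w n) /\<^sub>R real n) \<theta>"
  shows "(\<lambda>n. walk_expectation n [0] (\<lambda>x. real_of_int (x $ i)) / real n) \<longlonglongrightarrow> \<theta> $ i"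
proof -
  have meas: "(\<lambda>w. rvec (w n) /\<^sub>R real n) \<in> borel_measurable Q" for n
    by (rule measurable_function_of_position) simp
  have "(\<lambda>n. \<integral>w. (rvec (w n) /\<^sub>R real n) $ i \<partial>Q) \<longlonglongrightarrow> \<theta> $ i"
  proof (rule bounded_convergence_in_prob)
    show "converges_in_prob Q (\<lambda>n w. (rvec (w n) /\<^sub>R real n) $ i) (\<theta> $ i)"
      by (rule converges_in_prob_component[OF prob_space_axioms meas conv])
    show "(\<lambda>w. (rvec (w n) /\<^sub>R real n) $ i) \<in> borel_measurable Q" for n
      by (rule measurable_function_of_position) simp
    show "AE w in Q. \<bar>(rvec (w n) /\<^sub>R real n) $ i\<bar> \<le> \<bar>L\<bar>" for n
      using AE_path[of n]
    proof eventually_elim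
      case (elim w)
      have "\<bar>(rvec (w n) /\<^sub>R real n) $ i\<bar> \<le> norm (rvec (w n) /\<^sub>R real n)"
        by (rule component_le_norm_cart)
      also have "\<dots> = norm (rvec (w n)) / real n"
        by (simp add: divide_inverse mult.commute)
      also have "\<dots> \<le> \<bar>L\<bar>"
      proof (cases "n = 0")
        case False
        have "norm (rvec (w n)) \<le> real n * L"
          using norm_path_end_le[OF R elim] by simp
        also have "\<dots> \<le> \<bar>L\<bar> * real n"
          by (simp add: mult.commute mult_right_mono)
        finally show ?thesis using False by (simp add: divide_le_eq)
      qed simp
      finally show ?case .
    qed
  qed
  also have "(\<lambda>n. \<integral>w. (rvec (w n) /\<^sub>R real n) $ i \<partial>Q) =
      (\<lambda>n. (\<integral>w. real_of_int (w n $ i) \<partial>Q) / real n)"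
    by (simp add: rvec_def divide_inverse mult.commute)
  finally show ?thesis
    by (simp add: integral_position[of "\<lambda>x. real_of_int (x $ i)"])
qed

end

section \<open>The asymptotic covariance\<close>

lemma finite_lattice_ball: "finite {z :: 'd::finite point. norm (rvec z) \<le> L}"
proof (rule finite_imageD)
  have "vec_nth ` {z :: 'd point. norm (rvec z) \<le> L} \<subseteq> PiE UNIV (\<lambda>_. {- \<lceil>L\<rceil>..\<lceil>L\<rceil>})"
  proof (clarsimp simp: PiE_UNIV_domain)
    fix z :: "'d point" and i
    assume "norm (rvec z) \<le> L"
    then have "\<bar>real_of_int (z $ i)\<bar> \<le> L"
      using component_le_norm_cart[of "rvec z" i] by (simp add: rvec_def)
    then show "- \<lceil>L\<rceil> \<le> z $ i \<and> z $ i \<le> \<lceil>L\<rceil>" by linarith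
  qed
  then show "finite (vec_nth ` {z :: 'd point. norm (rvec z) \<le> L})"
    by (rule finite_subset) (intro finite_PiE, auto)
  show "inj_on vec_nth {z :: 'd point. norm (rvec z) \<le> L}"
    by (auto simp: inj_on_def vec_eq_iff)
qed

theorem theorem3p2:
  fixes p :: "'d::finite kernel"
    and L :: real
    and Q :: "(nat \<Rightarrow> 'd point) measure"
    and \<Sigma> :: "real ^ 'd ^ 'd"
    and \<theta> :: "real ^ 'd"
  assumes "translation_invariant p"
    and "finite_range p L"
    and "walk_law p Q"
    and "\<And>i j. (\<lambda>n. ((\<integral>w. real_of_int (w n $ i) * real_of_int (w n $ j) \<partial>Q)
              - (\<integral>w. real_of_int (w n $ i) \<partial>Q) * (\<integral>w. real_of_int (w n $ j) \<partial>Q)) / real n)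
            \<longlonglongrightarrow> \<Sigma> $ i $ j"
    and "\<And>i j. summable (\<lambda>k. second_moment p (k + 2) i j)"
    and "((\<forall>n i. (\<integral>w. real_of_int (w n $ i) \<partial>Q) = 0) \<and> \<theta> = 0) \<or>
         (converges_in_prob Q (\<lambda>n w. rvec (w n) /\<^sub>R real n) \<theta> \<and>
          (\<forall>i. summable (\<lambda>k. (real (k + 2) - 1) * \<bar>first_moment p (k + 2) i\<bar>)))"
  shows "\<forall>i j. \<Sigma> $ i $ j = Sigma_empty p i j - \<theta> $ i * \<theta> $ j
           - (\<Sum>k. \<theta> $ i * (real (k + 2) - 1) * first_moment p (k + 2) j
                 + \<theta> $ j * (real (k + 2) - 1) * first_moment p (k + 2) i
                 - second_moment p (k + 2) i j)"
proof (intro allI)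
  fix i j :: 'd
  define R where "R = {z :: 'd point. norm (rvec z) \<le> L}"
  have kernel: "short_range_kernel p R"
    using assms(2) unfolding short_range_kernel_def R_def finite_range_def
    by (auto simp: finite_lattice_ball) (metis not_le)
  interpret short_range_walk p R Q
    using kernel assms(3) by (simp add: short_range_walk_def short_range_walk_axioms_def walk_law_def)
  define X where "X i x = real_of_int (x $ i)" for i and x :: "'d point"
  define e where "e i n = walk_expectation n [0] (X i)" for i n
  define q where "q n = walk_expectation n [0] (\<lambda>x. X i x * X j x)" for n
  define a where "a i k = expansion_moment (k + 2) (X i)" for i k
  define d where "d i = (\<Sum>z\<in>R. D p z * X i z)" for i
  have a: "first_moment p (k + 2) i = a i k" for k i
    unfolding first_moment_def a_def X_def by (rule infsumI[OF has_sum_\<pi>]) simp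
  have s: "second_moment p (k + 2) i j = expansion_moment (k + 2) (\<lambda>x. X i x * X j x)" for k
    unfolding second_moment_def X_def by (rule infsumI[OF has_sum_\<pi>]) simp
  have S: "Sigma_empty p i j = (\<Sum>z\<in>R. D p z * (X i z * X j z))"
  proof -
    have "Sigma_empty p i j = (\<Sum>\<^sub>\<infinity>z\<in>R. D p z * (X i z * X j z))"
      unfolding Sigma_empty_def X_def
    proof (rule infsum_cong_neutral)
      fix z assume "z \<in> UNIV - R"
      then have "D p z = 0" using step_in_R[of "[0]" z] by (auto simp: D_def)
      then show "real_of_int (z $ i) * real_of_int (z $ j) * D p z = 0" by simp
    qed auto
    then show ?thesis by (simp add: finite_R)
  qed
  have e_rec: "e i (Suc n) = e i n + d i + (\<Sum>k<n. a i k)" for i n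
    unfolding e_def d_def a_def X_def by (rule coordinate_recursion[OF assms(1)])
  have q_rec: "q (Suc n) = q n + Sigma_empty p i j + d i * e j n + d j * e i n +
      (\<Sum>k<n. second_moment p (k + 2) i j + a i k * e j (n - Suc k) + a j k * e i (n - Suc k))" for n
    unfolding S s unfolding e_def d_def a_def q_def X_def by (rule product_recursion[OF assms(1)])
  have mean: "(\<integral>w. real_of_int (w n $ i) \<partial>Q) = e i n" for i n
    unfolding e_def X_def by (rule integral_position)
  \<comment> \<open>For a centred walk \<open>e\<close> is zero, so its recursion forces all \<open>a i k\<close> to be zero as well.\<close>
  have drift: "(\<lambda>n. e i n / real n) \<longlonglongrightarrow> \<theta> $ i \<and> summable (\<lambda>k. real (Suc k) * \<bar>a i k\<bar>)" for i
    using assms(6)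
  proof (elim disjE conjE)
    assume centered: "\<forall>n i. (\<integral>w. real_of_int (w n $ i) \<partial>Q) = 0" and "\<theta> = 0"
    then have e: "e i n = 0" for n by (simp add: mean)
    then have "(\<Sum>k<n. a i k) = - d i" for n using e_rec[of i n] by simp
    from this[of "Suc _"] this have "a i k = 0" for k by (simp add: lessThan_Suc)
    then show ?thesis using e \<open>\<theta> = 0\<close> by simp
  next
    assume "converges_in_prob Q (\<lambda>n w. rvec (w n) /\<^sub>R real n) \<theta>"
      and summable: "\<forall>i. summable (\<lambda>k. (real (k + 2) - 1) * \<bar>first_moment p (k + 2) i\<bar>)"
    then have "(\<lambda>n. e i n / real n) \<longlonglongrightarrow> \<theta> $ i"
      unfolding e_def X_def by (intro mean_velocity) (auto simp: R_def)
    moreover have "summable (\<lambda>k. real (Suc k) * \<bar>a i k\<bar>)"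
      using summable[rule_format, of i] unfolding a by (simp add: add.commute)
    ultimately show ?thesis by blast
  qed
  have "(\<lambda>n. (q n - e i n * e j n) / real n) \<longlonglongrightarrow>
     Sigma_empty p i j - \<theta> $ i * \<theta> $ j -
     (\<Sum>k. \<theta> $ i * real (Suc k) * a j k + \<theta> $ j * real (Suc k) * a i k - second_moment p (k + 2) i j)"
    by (rule variance_limit[OF e_rec e_rec q_rec]) (use drift assms(5) in auto)
  moreover have "(\<lambda>n. (q n - e i n * e j n) / real n) \<longlonglongrightarrow> \<Sigma> $ i $ j"
    using assms(4)[of i j] integral_position[of "\<lambda>x. X i x * X j x"]
    by (simp add: mean q_def X_def)
  ultimately have "\<Sigma> $ i $ j = Sigma_empty p i j - \<theta> $ i * \<theta> $ j -
     (\<Sum>k. \<theta> $ i * real (Suc k) * a j k + \<theta> $ j * real (Suc k) * a i k - second_moment p (k + 2) i j)"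
    using LIMSEQ_unique by blast
  moreover have "real (k + 2) - 1 = real (Suc k)" for k by simp
  ultimately show "\<Sigma> $ i $ j = Sigma_empty p i j - \<theta> $ i * \<theta> $ j
           - (\<Sum>k. \<theta> $ i * (real (k + 2) - 1) * first_moment p (k + 2) j
                 + \<theta> $ j * (real (k + 2) - 1) * first_moment p (k + 2) i
                 - second_moment p (k + 2) i j)"
    by (simp only: a)
qed

end
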